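(* Let $n\ge 2$ be an integer. Then $$\mathcal{L}\left(\frac1n\right)=\sum_{k=1}^{\infty}\mathcal{L}\left(\left(\frac{n^{k/2}}{n^k+n^{k-1}+\cdots+n^2+n+1}\right)^2\right).$$ In particular, when $n=2$, $$\frac{\pi^2}{12}=\mathcal{L}\left(\frac12\right)=\sum_{k=1}^{\infty}\mathcal{L}\left(\frac{2^k}{(2^{k+1}-1)^2}\right).$$
   Context: The Rogers dilogarithm is the function on $[0,1]$ given by $\mathcal{L}(z)=\mathrm{Li}_2(z)+\frac12\log|z|\log(1-z)$, where $\mathrm{Li}_2(z)=\sum_{n\ge1}z^n/n^2$, with $\mathcal{L}(0)=0$ and $\mathcal{L}(1)=\pi^2/6$. The denominator in the first identity is $\sum_{j=0}^{k}n^j$. *)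

theory Defs
  imports "HOL-Analysis.Analysis"
begin

definition dilog :: "real \<Rightarrow> real" where
  "dilog z = (\<Sum>n. z ^ Suc n / (real (Suc n))\<^sup>2)"

text \<open>The function is only meaningful on the closed unit interval. Its two endpoint
  values are prescribed separately, as the product of logarithms is undefined there.\<close>

definition rogers_dilog :: "real \<Rightarrow> real" where
  "rogers_dilog z =
     (if z = 0 then 0
      else if z = 1 then pi\<^sup>2 / 6
      else dilog z + 1 / 2 * ln \<bar>z\<bar> * ln (1 - z))"

end

theory Submission
  imports Defs "HOL-Real_Asymp.Real_Asymp"
begin

text \<open>For \<open>q = 1 / n\<close> put \<open>w k = (1 - q) / (1 - q ^ Suc k)\<close> and \<open>v k = q ^ k * w k\<close>. The \<open>k\<close>-th
  argument of the series is \<open>v k * w k\<close>, and the five-term relation at \<open>(v k, w k)\<close> has the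
  remaining two arguments \<open>v (Suc k)\<close> and \<open>w (Suc k)\<close>, so the series telescopes. Since
  \<open>v 1 + w 1 = 1\<close>, \<open>v k \<rightarrow> 0\<close> and \<open>w k \<rightarrow> 1 - q\<close>, the reflection formula evaluates the sum.\<close>

section \<open>The dilogarithm series on the unit interval\<close>

lemma dilog_0 [simp]: "dilog 0 = 0"
  by (simp add: dilog_def)

lemma dilog_1 [simp]: "dilog 1 = pi\<^sup>2 / 6"
  using inverse_squares_sums by (simp add: dilog_def sums_iff add_ac)

text \<open>The convergent series of \<open>1 / (Suc k)^2\<close> dominates uniformly up to and
  including \<open>z = 1\<close>, so the M-test covers the endpoint.\<close>

lemma continuous_on_dilog: "continuous_on {0..1} dilog"
proof -
  have "uniform_limit {0..1} (\<lambda>n z. \<Sum>k<n. z ^ Suc k / (real (Suc k))\<^sup>2)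
          (\<lambda>z. \<Sum>k. z ^ Suc k / (real (Suc k))\<^sup>2) sequentially"
  proof (rule Weierstrass_m_test)
    show "summable (\<lambda>k. 1 / (real (Suc k))\<^sup>2)"
      using inverse_squares_sums by (simp add: sums_iff add_ac)
    show "norm (z ^ Suc k / (real (Suc k))\<^sup>2) \<le> 1 / (real (Suc k))\<^sup>2"
      if "z \<in> {0..1}" for k and z :: real
    proof -
      have "z ^ Suc k \<le> 1"
        using that by (intro power_le_one) auto
      then show ?thesis
        using that by (simp add: divide_right_mono del: power_Suc of_nat_Suc)
    qed
  qed
  then have "continuous_on {0..1} (\<lambda>z. \<Sum>k. z ^ Suc k / (real (Suc k))\<^sup>2)"
    by (rule uniform_limit_theorem[rotated])
       (auto intro!: always_eventually continuous_intros simp del: of_nat_Suc)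
  then show ?thesis
    by (simp add: dilog_def[abs_def])
qed

text \<open>Termwise differentiation turns the series into the sum of
  \<open>z ^ n / (n + 1)\<close>, which is the logarithm series divided by \<open>z\<close>.\<close>

lemma dilog_has_real_derivative:
  assumes "0 < z" "z < 1"
  shows "(dilog has_real_derivative - ln (1 - z) / z) (at z)"
proof -
  \<comment> \<open>Division by zero gives \<open>c 0 = 0\<close>, so the unshifted power series
    with coefficients \<open>c\<close> has the same sum as the shifted one in
    \<open>dilog_def\<close>.\<close>
  define c :: "nat \<Rightarrow> real" where "c n = 1 / (real n)\<^sup>2" for n
  have summ: "summable (\<lambda>n. c n * 1 ^ n)"
    unfolding c_def using inverse_squares_sums
    by (subst summable_Suc_iff[symmetric]) (simp add: sums_iff add_ac)
  have sums_dilog: "(\<lambda>n. c n * x ^ n) sums dilog x" if "\<bar>x\<bar> < 1" for x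
  proof -
    have "summable (\<lambda>n. c n * x ^ n)"
      using powser_inside[OF summ, of x] that by simp
    then have "(\<lambda>n. c n * x ^ n) sums (\<Sum>n. c n * x ^ n)"
      by (rule summable_sums)
    moreover have "(\<Sum>n. c n * x ^ n) = dilog x"
      using suminf_split_head[OF \<open>summable (\<lambda>n. c n * x ^ n)\<close>]
      by (simp add: dilog_def c_def)
    ultimately show ?thesis by simp
  qed
  have D: "((\<lambda>x. \<Sum>n. c n * x ^ n) has_real_derivative (\<Sum>n. diffs c n * z ^ n)) (at z)"
    using assms by (intro termdiffs_strong[OF summ]) auto
  have "((\<lambda>x. \<Sum>n. c n * x ^ n) has_real_derivative d) (at z) \<longleftrightarrow>
        (dilog has_real_derivative d) (at z)" for d
  proof (rule DERIV_cong_ev)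
    have "eventually (\<lambda>x. x \<in> {-1<..<1::real}) (nhds z)"
      using assms by (intro eventually_nhds_in_open) auto
    then show "eventually (\<lambda>x. (\<Sum>n. c n * x ^ n) = dilog x) (nhds z)"
      by eventually_elim (use sums_dilog in \<open>auto simp: sums_iff abs_less_iff\<close>)
  qed auto
  moreover have "(\<Sum>n. diffs c n * z ^ n) = - ln (1 - z) / z"
  proof -
    have eq: "diffs c n * z ^ n = 1 / real (Suc n) * z ^ n" for n
      by (simp add: diffs_def c_def power2_eq_square)
    have "summable (\<lambda>n. diffs c n * z ^ n)"
      using assms by (intro termdiff_converges[where K = 1] sums_summable[OF sums_dilog]) auto
    then have summ': "summable (\<lambda>n. z * (diffs c n * z ^ n))"
      and "z * (\<Sum>n. diffs c n * z ^ n) = (\<Sum>n. z * (diffs c n * z ^ n))"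
      by (rule summable_mult, rule suminf_mult[symmetric])
    moreover have "ln (1 - z) = (\<Sum>n. - (z * (diffs c n * z ^ n)))"
    proof -
      have "ln (1 - z) = (\<Sum>n. (-1) ^ n * (1 / real (n + 1)) * ((1 - z) - 1) ^ Suc n)"
        using assms by (intro ln_series) auto
      \<comment> \<open>The signs combine:
        \<open>(-1) ^ n * (- z) ^ Suc n = - (z ^ Suc n)\<close>.\<close>
      also have "\<dots> = (\<Sum>n. - (z * (diffs c n * z ^ n)))"
        by (rule suminf_cong) (simp add: eq uminus_power_if)
      finally show ?thesis .
    qed
    ultimately show ?thesis
      using suminf_minus[OF summ'] assms by (simp add: field_simps)
  qed
  ultimately show ?thesis
    using D by simp
qed

section \<open>The Rogers dilogarithm: continuity and derivative\<close>

text \<open>The library's \<open>ln 0 = 0\<close> makes the generic formula agree with the prescribed endpoint values.\<close>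

lemma rogers_dilog_altdef:
  assumes "0 \<le> z"
  shows "rogers_dilog z = dilog z + 1 / 2 * (ln z * ln (1 - z))"
  using assms by (simp add: rogers_dilog_def)

text \<open>At each endpoint one logarithm diverges while the other vanishes linearly, so the
  product tends to 0. Its value there is 0 as well, one factor being \<open>ln 1\<close>.\<close>

lemma continuous_on_ln_mult_ln: "continuous_on {0..1} (\<lambda>x::real. ln x * ln (1 - x))"
  unfolding continuous_on_eq_continuous_within
proof
  fix x :: real
  assume x: "x \<in> {0..1}"
  consider "x = 0" | "x = 1" | "0 < x" "x < 1"
    using x by fastforce
  then show "continuous (at x within {0..1}) (\<lambda>x. ln x * ln (1 - x))"
  proof cases
    case 1
    have "((\<lambda>x::real. ln x * ln (1 - x)) \<longlongrightarrow> 0) (at_right 0)"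
      by real_asymp
    with 1 show ?thesis
      by (simp add: continuous_within at_within_Icc_at_right)
  next
    case 2
    have "((\<lambda>x::real. ln x * ln (1 - x)) \<longlongrightarrow> 0) (at_left 1)"
      by real_asymp
    with 2 show ?thesis
      by (simp add: continuous_within at_within_Icc_at_left)
  next
    case 3
    then show ?thesis
      by (intro continuous_intros) auto
  qed
qed

lemma continuous_on_rogers_dilog: "continuous_on {0..1} rogers_dilog"
proof -
  have "continuous_on {0..1} (\<lambda>z. dilog z + 1 / 2 * (ln z * ln (1 - z)))"
    by (intro continuous_intros continuous_on_dilog continuous_on_ln_mult_ln)
  then show ?thesis
    by (rule continuous_on_eq) (simp add: rogers_dilog_altdef)
qed

lemma rogers_dilog_has_real_derivative:
  assumes "0 < z" "z < 1"
  shows "(rogers_dilog has_real_derivative - (ln (1 - z) / z + ln z / (1 - z)) / 2) (at z)"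
proof -
  have "((\<lambda>z. dilog z + 1 / 2 * (ln z * ln (1 - z))) has_real_derivative
          - (ln (1 - z) / z + ln z / (1 - z)) / 2) (at z)"
    using assms
    by (auto intro!: derivative_eq_intros dilog_has_real_derivative simp: field_simps)
  moreover have "eventually (\<lambda>x. x \<in> {0<..}) (nhds z)"
    using assms by (intro eventually_nhds_in_open) auto
  then have "eventually (\<lambda>x. rogers_dilog x = dilog x + 1 / 2 * (ln x * ln (1 - x))) (nhds z)"
    by eventually_elim (simp add: rogers_dilog_altdef)
  ultimately show ?thesis
    by (simp only: DERIV_cong_ev[OF refl _ refl])
qed

lemmas rogers_dilog_derivative_intros [derivative_intros] =
  DERIV_chain2[OF rogers_dilog_has_real_derivative]

section \<open>Functional equations: reflection and the five-term relation\<close>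

text \<open>The derivative of \<open>rogers_dilog\<close> is invariant under \<open>z\<close> to
  \<open>1 - z\<close>, so the chain rule makes the two terms cancel. Continuity up to the boundary
  allows the constant to be read off at 0.\<close>

lemma rogers_dilog_reflection:
  assumes "0 \<le> x" "x \<le> 1"
  shows "rogers_dilog x + rogers_dilog (1 - x) = pi\<^sup>2 / 6"
proof -
  define f where "f x = rogers_dilog x + rogers_dilog (1 - x)" for x
  have "f x = f 0"
  proof (rule DERIV_isconst2[where f = f and a = 0 and b = 1])
    show "continuous_on {0..1} f"
      unfolding f_def
      by (intro continuous_intros continuous_on_rogers_dilog
            continuous_on_compose2[OF continuous_on_rogers_dilog]) auto
    show "(f has_real_derivative 0) (at x)" if "0 < x" "x < 1" for x
      unfolding f_def using that by (auto intro!: derivative_eq_intros simp: field_simps)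
  qed (use assms in auto)
  then show ?thesis
    by (simp add: f_def rogers_dilog_def)
qed

text \<open>For fixed \<open>y\<close>, the terms depending on \<open>x\<close> are collected in
  \<open>f\<close>, whose derivative vanishes. At \<open>x = 0\<close> only
  \<open>- rogers_dilog y\<close> remains.\<close>

lemma rogers_dilog_five_term:
  assumes "0 < x" "x < 1" "0 < y" "y < 1"
  shows "rogers_dilog x + rogers_dilog y = rogers_dilog (x * y)
           + rogers_dilog (x * (1 - y) / (1 - x * y)) + rogers_dilog (y * (1 - x) / (1 - x * y))"
proof -
  define f where "f x = rogers_dilog x - rogers_dilog (x * y)
      - rogers_dilog (x * (1 - y) / (1 - x * y)) - rogers_dilog (y * (1 - x) / (1 - x * y))" for x
  \<comment> \<open>Since \<open>y < 1\<close>, the common denominator \<open>1 - x * y\<close>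
    stays positive even at \<open>x = 1\<close>, as continuity on the closed interval
    requires.\<close>
  have xy: "x * y < 1" if "x \<le> 1" for x
    by (rule le_less_trans[OF mult_right_mono[OF that less_imp_le[OF assms(3)]]]) (use assms in simp)
  have "f x = f 0"
  proof (rule DERIV_isconst2[where f = f and a = 0 and b = 1])
    have mem: "x * y \<in> {0..1}" "x * (1 - y) / (1 - x * y) \<in> {0..1}"
              "y * (1 - x) / (1 - x * y) \<in> {0..1}" if "x \<in> {0..1}" for x
      using that xy[of x] assms by (auto simp: divide_simps algebra_simps mult_left_le)
    show "continuous_on {0..1} f"
      unfolding f_def
      by (intro continuous_intros continuous_on_rogers_dilog
            continuous_on_compose2[OF continuous_on_rogers_dilog])
         (use mem xy in \<open>force+\<close>)
    show "(f has_real_derivative 0) (at x)" if x: "0 < x" "x < 1" for x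
    proof -
      define d where "d = 1 - x * y"
      have d: "d > 0"
        using xy[of x] x by (simp add: d_def)
      define u where "u = x * (1 - y) / d"
      define v where "v = y * (1 - x) / d"
      have u: "0 < u" and v: "0 < v"
        using x assms d by (simp_all add: u_def v_def)
      have u': "1 - u = (1 - x) / d" and v': "1 - v = (1 - y) / d"
        using d by (simp_all add: u_def v_def d_def field_simps)
      have u1: "u < 1" and v1: "v < 1"
        using u' v' x assms d by (smt (verit) divide_pos_pos)+
      have Du: "((\<lambda>x. x * (1 - y) / (1 - x * y)) has_real_derivative (1 - y) / d\<^sup>2) (at x)"
        using d unfolding d_def
        by (auto intro!: derivative_eq_intros simp: field_simps power2_eq_square)
      have Dv: "((\<lambda>x. y * (1 - x) / (1 - x * y)) has_real_derivative - (y * (1 - y)) / d\<^sup>2) (at x)"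
        using d unfolding d_def
        by (auto intro!: derivative_eq_intros simp: field_simps power2_eq_square)
      \<comment> \<open>The arguments and their complements are products and quotients of
        \<open>x\<close>, \<open>1 - x\<close>, \<open>y\<close>, \<open>1 - y\<close> and
        \<open>d\<close>, so the derivative of \<open>f\<close> is linear in five
        logarithms.\<close>
      have ln_u: "ln u = ln x + ln (1 - y) - ln d" "ln (1 - u) = ln (1 - x) - ln d"
        and ln_v: "ln v = ln y + ln (1 - x) - ln d" "ln (1 - v) = ln (1 - y) - ln d"
        unfolding u' v' using x assms d by (simp_all add: u_def v_def ln_mult ln_div)
      have Lxy: "((\<lambda>x. rogers_dilog (x * y)) has_real_derivative
          - (ln d / (x * y) + (ln x + ln y) / d) / 2 * y) (at x)"
        using x assms d unfolding d_def
        by (auto intro!: derivative_eq_intros simp: ln_mult)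
      have Lu: "((\<lambda>x. rogers_dilog (x * (1 - y) / (1 - x * y))) has_real_derivative
          - (ln (1 - u) / u + ln u / (1 - u)) / 2 * ((1 - y) / d\<^sup>2)) (at x)"
        by (rule DERIV_chain2[OF rogers_dilog_has_real_derivative[OF u u1, unfolded u_def d_def]
              Du, folded d_def, folded u_def])
      have Lv: "((\<lambda>x. rogers_dilog (y * (1 - x) / (1 - x * y))) has_real_derivative
          - (ln (1 - v) / v + ln v / (1 - v)) / 2 * (- (y * (1 - y)) / d\<^sup>2)) (at x)"
        by (rule DERIV_chain2[OF rogers_dilog_has_real_derivative[OF v v1, unfolded v_def d_def]
              Dv, folded d_def, folded v_def])
      have U: "(ln (1 - u) / u + ln u / (1 - u)) * ((1 - y) / d\<^sup>2)
          = (ln (1 - x) - ln d) / (x * d) + (ln x + ln (1 - y) - ln d) * (1 - y) / ((1 - x) * d)"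
        unfolding ln_u unfolding u' distrib_right using x assms d
        by (intro arg_cong2[where f = "(+)"]) (simp_all add: u_def power2_eq_square)
      have V: "(ln (1 - v) / v + ln v / (1 - v)) * (- (y * (1 - y)) / d\<^sup>2)
          = - ((ln (1 - y) - ln d) * (1 - y) / ((1 - x) * d)) + - ((ln y + ln (1 - x) - ln d) * y / d)"
        unfolding ln_v unfolding v' distrib_right using x assms d
        by (intro arg_cong2[where f = "(+)"]) (simp_all add: v_def power2_eq_square)
      have "(f has_real_derivative - (ln (1 - x) / x + ln x / (1 - x)) / 2
          - - (ln d / (x * y) + (ln x + ln y) / d) / 2 * y
          - - (ln (1 - u) / u + ln u / (1 - u)) / 2 * ((1 - y) / d\<^sup>2)
          - - (ln (1 - v) / v + ln v / (1 - v)) / 2 * (- (y * (1 - y)) / d\<^sup>2)) (at x)"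
        unfolding f_def
        by (intro DERIV_diff Lxy Lu Lv rogers_dilog_has_real_derivative x)
      \<comment> \<open>Regrouping makes the left-hand sides of \<open>U\<close> and
        \<open>V\<close> appear literally, ready for rewriting.\<close>
      moreover have "- A / 2 - - B / 2 * y - - C / 2 * r - - D / 2 * s
          = (- A + B * y + C * r + D * s) / 2" for A B C D r s :: real
        by (simp add: field_simps)
      \<comment> \<open>\<open>A\<close>, \<open>B\<close>, \<open>C\<close>, \<open>D\<close>,
        \<open>E\<close> stand for the logarithms of \<open>1 - x\<close>, \<open>x\<close>,
        \<open>y\<close>, \<open>d\<close>, \<open>1 - y\<close>. The coefficient of each vanishes
        separately, by the partial fractions of \<open>1 / (x * d)\<close> and
        \<open>(1 - y) / ((1 - x) * d)\<close>.\<close>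
      moreover have "- (A / x + B / (1 - x)) + (D / (x * y) + (B + C) / d) * y
          + ((A - D) / (x * d) + (B + E - D) * (1 - y) / ((1 - x) * d))
          + (- ((E - D) * (1 - y) / ((1 - x) * d)) + - ((C + A - D) * y / d)) = 0"
        for A B C D E :: real
      proof -
        have "D / (x * y) * y = D / x"
          using assms by simp
        moreover have "1 / (x * d) = 1 / x + y / d"
          using x d by (simp add: d_def field_simps)
        moreover have "(1 - y) / ((1 - x) * d) = 1 / (1 - x) - y / d"
          using x d by (simp add: d_def field_simps)
        moreover have "(A - D) / (x * d) = (A - D) * (1 / (x * d))"
          "(B + E - D) * (1 - y) / ((1 - x) * d) = (B + E - D) * ((1 - y) / ((1 - x) * d))"
          "(E - D) * (1 - y) / ((1 - x) * d) = (E - D) * ((1 - y) / ((1 - x) * d))"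
          by simp_all
        moreover have "(B + C) / d * y = (B + C) * (y / d)" "(C + A - D) * y / d = (C + A - D) * (y / d)"
          "A / x = A * (1 / x)" "D / x = D * (1 / x)" "B / (1 - x) = B * (1 / (1 - x))"
          by simp_all
        ultimately show ?thesis
          unfolding distrib_right by algebra
      qed
      ultimately show ?thesis
        by (simp only: U V) simp
    qed
  qed (use assms in auto)
  then show ?thesis
    by (simp add: f_def rogers_dilog_def[of 0])
qed

section \<open>The telescoping series\<close>

lemma rogers_dilog_sums:
  assumes "0 < q" "q < 1"
  shows "(\<lambda>k. rogers_dilog (q ^ Suc k * ((1 - q) / (1 - q ^ Suc (Suc k)))\<^sup>2)) sums rogers_dilog q"
proof -
  define w where "w k = (1 - q) / (1 - q ^ Suc k)" for k
  define v where "v k = q ^ k * w k" for k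
  have less_1: "q ^ Suc k < 1" for k
    using assms by (intro power_Suc_less_one) auto
  \<comment> \<open>Indices start at 1 because \<open>w 0 = v 0 = 1\<close> lies outside the open
    interval of the five-term relation.\<close>
  have w: "0 < w (Suc k)" "w (Suc k) < 1" for k
    using assms less_1[of k] less_1[of "Suc k"] by (auto simp: w_def field_simps)
  have v: "0 < v (Suc k)" "v (Suc k) < 1" for k
  proof -
    show "0 < v (Suc k)"
      using assms w by (simp add: v_def)
    show "v (Suc k) < 1"
      unfolding v_def using mult_strict_mono[OF less_1[of k] w(2)[of k]] assms w(1)[of k] by simp
  qed
  define g where "g k = rogers_dilog (v (Suc k)) + rogers_dilog (w (Suc k))" for k
  have step: "g k - g (Suc k) = rogers_dilog (q ^ Suc k * (w (Suc k))\<^sup>2)" for k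
  proof -
    define a where "a = q ^ Suc k"
    have a: "0 < a" "a < 1"
      using assms less_1[of k] by (simp_all add: a_def)
    have b: "q * a < 1" "q * (q * a) < 1"
      using less_1[of "Suc k"] less_1[of "Suc (Suc k)"] by (simp_all add: a_def)
    have W: "w (Suc k) = (1 - q) / (1 - q * a)" "w (Suc (Suc k)) = (1 - q) / (1 - q * (q * a))"
      and V: "v (Suc k) = a * w (Suc k)" "v (Suc (Suc k)) = q * a * w (Suc (Suc k))"
      by (simp_all add: w_def v_def a_def)
    \<comment> \<open>In the two quotients below, \<open>1 - a\<close> and the powers of
      \<open>1 - q * a\<close> cancel against this factorization. The surviving denominator
      \<open>1 - q * (q * a)\<close> is the one of the next index.\<close>
    have "1 - v (Suc k) * w (Suc k) = (1 - a) * (1 - q * (q * a)) / (1 - q * a)\<^sup>2"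
      unfolding V W using b by (simp add: divide_simps power2_eq_square) (simp add: algebra_simps)
    moreover have "1 - w (Suc k) = q * (1 - a) / (1 - q * a)"
      unfolding W using b by (simp add: field_simps)
    moreover have "1 - v (Suc k) = (1 - a) / (1 - q * a)"
      unfolding V W using b by (simp add: field_simps)
    ultimately have "v (Suc k) * (1 - w (Suc k)) / (1 - v (Suc k) * w (Suc k)) = v (Suc (Suc k))"
      "w (Suc k) * (1 - v (Suc k)) / (1 - v (Suc k) * w (Suc k)) = w (Suc (Suc k))"
      unfolding V W using a b by (simp_all add: divide_simps power2_eq_square)
    moreover have "v (Suc k) * w (Suc k) = q ^ Suc k * (w (Suc k))\<^sup>2"
      by (simp add: V a_def power2_eq_square)
    ultimately show ?thesis
      using rogers_dilog_five_term[OF v[of k] w[of k]] by (simp add: g_def)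
  qed
  have q_lim: "(\<lambda>k. q ^ k) \<longlonglongrightarrow> 0"
    using assms by (intro LIMSEQ_power_zero) auto
  have w_lim: "(\<lambda>k. w (Suc k)) \<longlonglongrightarrow> 1 - q"
    unfolding w_def using tendsto_divide[OF tendsto_const tendsto_diff[OF tendsto_const
        LIMSEQ_Suc[OF LIMSEQ_Suc[OF q_lim]]], of 1 "1 - q"] by simp
  have v_lim: "(\<lambda>k. v (Suc k)) \<longlonglongrightarrow> 0"
    unfolding v_def using tendsto_mult[OF LIMSEQ_Suc[OF q_lim] w_lim] by simp
  \<comment> \<open>The limit 0 of \<open>v\<close> is a boundary point, so continuity on the closed
    interval is used, with both sequences staying inside it.\<close>
  have "g \<longlonglongrightarrow> rogers_dilog 0 + rogers_dilog (1 - q)"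
    unfolding g_def using assms v w
    by (intro tendsto_add continuous_on_tendsto_compose[OF continuous_on_rogers_dilog] v_lim w_lim)
       (auto intro!: always_eventually less_imp_le)
  then have "(\<lambda>k. g k - g (Suc k)) sums (g 0 - (rogers_dilog 0 + rogers_dilog (1 - q)))"
    by (rule telescope_sums')
  moreover have "g 0 = pi\<^sup>2 / 6"
  proof -
    \<comment> \<open>Explicitly, \<open>w 1 = 1 / (1 + q)\<close> and
      \<open>v 1 = q / (1 + q)\<close>.\<close>
    have "w (Suc 0) = 1 - v (Suc 0)"
      using assms less_1[of 1] by (simp add: v_def w_def field_simps)
    then show ?thesis
      using rogers_dilog_reflection[of "v (Suc 0)"] v[of 0] by (simp add: g_def)
  qed
  moreover have "pi\<^sup>2 / 6 - (rogers_dilog 0 + rogers_dilog (1 - q)) = rogers_dilog q"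
    using rogers_dilog_reflection[of q] assms by (simp add: rogers_dilog_def[of 0])
  ultimately show ?thesis
    by (simp add: step w_def)
qed

section \<open>Specialization to \<open>q = 1 / n\<close>\<close>

theorem corollary1p4:
  shows "(\<forall>n::nat. n \<ge> 2 \<longrightarrow>
           (\<lambda>k. rogers_dilog
              ((real n powr (real (Suc k) / 2) / (\<Sum>j=0..Suc k. real n ^ j))\<^sup>2))
             sums rogers_dilog (1 / real n))
       \<and> pi\<^sup>2 / 12 = rogers_dilog (1 / 2)
       \<and> (\<lambda>k. rogers_dilog (2 ^ Suc k / (2 ^ (Suc k + 1) - 1)\<^sup>2))
             sums rogers_dilog (1 / 2)"
proof (intro conjI allI impI)
  \<comment> \<open>Clearing negative powers of \<open>x\<close>: the squared quotient contributes
    \<open>x ^ (2 * Suc k)\<close>, of which \<open>(1 / x) ^ Suc k\<close> leaves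
    \<open>x ^ Suc k\<close>.\<close>
  have arg: "(1 / x) ^ Suc k * ((1 - 1 / x) / (1 - (1 / x) ^ Suc (Suc k)))\<^sup>2
      = x ^ Suc k * ((x - 1) / (x ^ Suc (Suc k) - 1))\<^sup>2" if "1 < x" for x :: real and k
  proof -
    define y where "y = x ^ Suc k"
    have y: "1 < y" "1 < x * y"
      unfolding y_def using that one_less_power[of x "Suc k"] one_less_power[of x "Suc (Suc k)"]
      by simp_all
    have "1 - 1 / x = (x - 1) / x" "1 - 1 / (x * y) = (x * y - 1) / (x * y)"
      using that y by (simp_all add: field_simps)
    then have "1 / y * ((1 - 1 / x) / (1 - 1 / (x * y)))\<^sup>2 = y * ((x - 1) / (x * y - 1))\<^sup>2"
      using that y by (simp add: power2_eq_square)
    then show ?thesis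
      by (simp add: y_def power_one_over)
  qed
  show "(\<lambda>k. rogers_dilog
              ((real n powr (real (Suc k) / 2) / (\<Sum>j=0..Suc k. real n ^ j))\<^sup>2))
             sums rogers_dilog (1 / real n)" if "n \<ge> 2" for n :: nat
  proof -
    have n: "1 < real n"
      using that by simp
    have "(real n powr (real (Suc k) / 2) / (\<Sum>j=0..Suc k. real n ^ j))\<^sup>2
        = real n ^ Suc k * ((real n - 1) / (real n ^ Suc (Suc k) - 1))\<^sup>2" for k
    proof -
      have "(real n powr (real (Suc k) / 2))\<^sup>2 = real n powr real (Suc k)"
        by (simp add: power2_eq_square flip: powr_add)
      also have "\<dots> = real n ^ Suc k"
        using n by (intro powr_realpow) simp
      finally have "(real n powr (real (Suc k) / 2))\<^sup>2 = real n ^ Suc k" .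
      \<comment> \<open>The sum has \<open>Suc (Suc k)\<close> terms, whence the exponent in the
        geometric formula.\<close>
      moreover have "(\<Sum>j=0..Suc k. real n ^ j) = (real n ^ Suc (Suc k) - 1) / (real n - 1)"
        using n geometric_sum[of "real n" "Suc (Suc k)"]
        by (simp only: atLeast0AtMost lessThan_Suc_atMost)
      ultimately show ?thesis
        by (simp only: power_divide) simp
    qed
    then show ?thesis
      using rogers_dilog_sums[of "1 / real n"] arg[OF n] n by simp
  qed
  \<comment> \<open>The point \<open>1 / 2\<close> is fixed by \<open>x\<close> to
    \<open>1 - x\<close>, so reflection gives twice its value.\<close>
  show "pi\<^sup>2 / 12 = rogers_dilog (1 / 2)"
    using rogers_dilog_reflection[of "1 / 2"] by simp
  \<comment> \<open>For \<open>x = 2\<close> the factor \<open>x - 1\<close> in \<open>arg\<close>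
    equals 1.\<close>
  show "(\<lambda>k. rogers_dilog (2 ^ Suc k / (2 ^ (Suc k + 1) - 1)\<^sup>2)) sums rogers_dilog (1 / 2)"
    using rogers_dilog_sums[of "1 / 2"] arg[of 2] by (simp add: power_divide)
qed

end
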